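(* Let $R\subset S$ be an FCP extension, let $n\geq 1$, and let $\mathcal C=\{T_1\subset T_2\subset\cdots\subset T_n\}$ be a finite chain of elements of $[R,S]\setminus\{R,S\}$ such that $R\subset S$ is pinched at $\mathcal C$. Set $T_0:=R$ and $T_{n+1}:=S$. Then $R\subset S$ is distributive if and only if $T_i\subset T_{i+1}$ is distributive for each $i\in\{0,\ldots,n\}$.
   Context: All rings are commutative with unit. $[R,S]$ denotes the set of all $R$-subalgebras of $S$, ordered by inclusion; it is a lattice in which the infimum of $T,U$ is $T\cap U$ and the supremum is the compositum $TU$. The extension $R\subseteq S$ is called distributive if the lattice $[R,S]$ is distributive. It has FCP (is an FCP extension) if every chain in $[R,S]$ is finite. The extension $R\subset S$ is called pinched at a finite chain $\mathcal C=\{T_1\subset\cdots\subset T_n\}\subseteq[R,S]\setminus\{R,S\}$ if $[R,S]=\bigcup_{i=0}^{n}[T_i,T_{i+1}]$, where $T_0:=R$ and $T_{n+1}:=S$; equivalently, every element of $[R,S]$ is comparable to each $T_i$. *)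

theory Defs
  imports "HOL-Algebra.Algebra"
begin

text \<open>
  An extension \<open>R \<subseteq> S\<close> is given by a commutative ring \<open>S\<close> and the carrier \<open>R\<close> of a (unital)
  subring of \<open>S\<close>. The \<open>R\<close>-subalgebras of \<open>S\<close> are then exactly the subrings of \<open>S\<close> containing \<open>R\<close>.
  An extension \<open>T \<subseteq> U\<close> inside \<open>S\<close> is written with the ring \<open>S\<lparr>carrier := U\<rparr>\<close> on top.
\<close>

definition intermediate_rings :: "'a set \<Rightarrow> ('a, 'b) ring_scheme \<Rightarrow> 'a set set" where
  "intermediate_rings R S = {T. subcring T S \<and> R \<subseteq> T}"

definition FCP_extension :: "'a set \<Rightarrow> ('a, 'b) ring_scheme \<Rightarrow> bool" where
  "FCP_extension R S \<longleftrightarrow> (\<forall>C. subset.chain (intermediate_rings R S) C \<longrightarrow> finite C)"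

definition extension_order :: "'a set \<Rightarrow> ('a, 'b) ring_scheme \<Rightarrow> 'a set gorder" where
  "extension_order R S = \<lparr>carrier = intermediate_rings R S, eq = (=), le = (\<subseteq>)\<rparr>"

locale distributive_lattice = lattice L for L (structure) +
  assumes meet_join_distrib:
    "\<lbrakk>x \<in> carrier L; y \<in> carrier L; z \<in> carrier L\<rbrakk>
      \<Longrightarrow> x \<sqinter> (y \<squnion> z) = (x \<sqinter> y) \<squnion> (x \<sqinter> z)"

definition distributive_extension :: "'a set \<Rightarrow> ('a, 'b) ring_scheme \<Rightarrow> bool" where
  "distributive_extension R S \<longleftrightarrow> distributive_lattice (extension_order R S)"

text \<open>
  Pinching at the chain \<open>T 1 \<subset> \<dots> \<subset> T n\<close>; the family is to be supplied with its end points
  \<open>T 0 = R\<close> and \<open>T (n + 1) = carrier S\<close>.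
\<close>

definition pinched_at :: "'a set \<Rightarrow> ('a, 'b) ring_scheme \<Rightarrow> nat \<Rightarrow> (nat \<Rightarrow> 'a set) \<Rightarrow> bool" where
  "pinched_at R S n T \<longleftrightarrow>
    intermediate_rings R S = (\<Union>i\<in>{0..n}. intermediate_rings (T i) (S\<lparr>carrier := T (Suc i)\<rparr>))"

text \<open>The order is a lattice, with intersection as infimum and compositum as supremum.\<close>

lemma extension_order_simps [simp]:
  "carrier (extension_order R S) = intermediate_rings R S"
  "T .=\<^bsub>extension_order R S\<^esub> U \<longleftrightarrow> T = U"
  "T \<sqsubseteq>\<^bsub>extension_order R S\<^esub> U \<longleftrightarrow> T \<subseteq> U"
  by (simp_all add: extension_order_def)

lemma partial_order_extension_order: "partial_order (extension_order R S)"
  by unfold_locales (auto simp: extension_order_def)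

lemma glb_extension_order:
  assumes "cring S" "T \<in> intermediate_rings R S" "U \<in> intermediate_rings R S"
  shows "is_glb (extension_order R S) (T \<inter> U) {T, U}"
proof -
  interpret cring S by fact
  have "T \<inter> U \<in> intermediate_rings R S"
    using assms by (auto simp: intermediate_rings_def intro: subcring_inter)
  then show ?thesis
    using assms by (auto simp: greatest_def Lower_def)
qed

lemma lub_extension_order:
  assumes "cring S" "T \<in> intermediate_rings R S" "U \<in> intermediate_rings R S"
  shows "is_lub (extension_order R S) (generate_ring S (T \<union> U)) {T, U}"
proof -
  interpret cring S by fact
  have TU: "T \<union> U \<subseteq> carrier S"
    using assms subcringE(1) by (fastforce simp: intermediate_rings_def)
  have inc: "T \<union> U \<subseteq> generate_ring S (T \<union> U)"
    by (auto intro: generate_ring.incl)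
  then have "generate_ring S (T \<union> U) \<in> intermediate_rings R S"
    using assms generate_ring_is_subring[OF TU]
    by (auto simp: intermediate_rings_def intro!: subcringI')
  moreover have "generate_ring S (T \<union> U) \<subseteq> V"
    if "V \<in> intermediate_rings R S" "T \<subseteq> V" "U \<subseteq> V" for V
    using that generate_ring_min_subring1[OF TU, of V]
    by (auto simp: intermediate_rings_def subcring_def)
  ultimately show ?thesis
    using assms inc by (auto simp: least_def Upper_def)
qed

lemma lattice_extension_order:
  assumes "cring S"
  shows "lattice (extension_order R S)"
proof -
  interpret partial_order "extension_order R S"
    by (rule partial_order_extension_order)
  show ?thesis
    by unfold_locales
      (use assms glb_extension_order lub_extension_order in \<open>fastforce+\<close>)
qed

lemma meet_extension_order:
  assumes "cring S" "T \<in> intermediate_rings R S" "U \<in> intermediate_rings R S"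
  shows "T \<sqinter>\<^bsub>extension_order R S\<^esub> U = T \<inter> U"
proof -
  interpret lattice "extension_order R S"
    using assms(1) by (rule lattice_extension_order)
  show ?thesis
    by (rule meetI) (use assms glb_extension_order[OF assms] greatest_unique in auto)
qed

lemma join_extension_order:
  assumes "cring S" "T \<in> intermediate_rings R S" "U \<in> intermediate_rings R S"
  shows "T \<squnion>\<^bsub>extension_order R S\<^esub> U = generate_ring S (T \<union> U)"
proof -
  interpret lattice "extension_order R S"
    using assms(1) by (rule lattice_extension_order)
  show ?thesis
    by (rule joinI) (use assms lub_extension_order[OF assms] least_unique in auto)
qed

end

theory Submission
  imports Defs
begin

text \<open>
  The pinching chain cuts the lattice into consecutive intervals \<open>[T i, T (i + 1)]\<close>, which
  makes the lattice an ordinal sum of these intervals glued at their end points. Each interval is a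
  sublattice: its members are the intermediate rings of the whole extension that lie between the end
  points, and the compositum of two of them is the same whether computed in \<open>T (i + 1)\<close> or
  in \<open>S\<close>. So distributivity passes to the intervals.

  Conversely, the only inequality to prove is
  \<open>A \<inter> BC \<subseteq> (A \<inter> B)(A \<inter> C)\<close>, and it is trivial as soon as \<open>B\<close> and \<open>C\<close> are comparable,
  \<open>A \<subseteq> B\<close>, or \<open>BC \<subseteq> A\<close>. Incomparable \<open>B\<close> and \<open>C\<close> must lie in the same interval; an \<open>A\<close> from
  a lower interval is then contained in \<open>B\<close>, one from a higher interval contains \<open>BC\<close>, and
  an \<open>A\<close> from the same interval is covered by the distributivity of that interval.
\<close>

lemma intermediate_rings_carrier_update:
  assumes "cring S" "subcring U S"
  shows "intermediate_rings T (S\<lparr>carrier := U\<rparr>) = {V \<in> intermediate_rings T S. V \<subseteq> U}"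
proof -
  interpret cring S by fact
  have U: "U \<subseteq> carrier S"
    by (rule subcringE(1)[OF assms(2)])
  interpret U: cring "S\<lparr>carrier := U\<rparr>"
    by (rule iffD1[OF subcring_iff[OF U] assms(2)])
  have "subcring V (S\<lparr>carrier := U\<rparr>) \<longleftrightarrow> subcring V S \<and> V \<subseteq> U" for V
  proof (cases "V \<subseteq> U")
    case True
    \<comment> \<open>Being a subring means being a ring under the inherited operations,
      and both ambient rings induce the same ones on \<open>V\<close>.\<close>
    then have "subcring V (S\<lparr>carrier := U\<rparr>) \<longleftrightarrow> cring (S\<lparr>carrier := V\<rparr>)"
      using U.subcring_iff[of V] by simp
    also have "\<dots> \<longleftrightarrow> subcring V S"
      using subcring_iff[of V] True U by blast
    finally show ?thesis using True by simp
  next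
    case False
    then show ?thesis using subcringE(1)[of V "S\<lparr>carrier := U\<rparr>"] by auto
  qed
  then show ?thesis by (auto simp: intermediate_rings_def)
qed

lemma generate_ring_intermediate:
  assumes "cring S" "B \<in> intermediate_rings R S" "C \<in> intermediate_rings R S"
  shows "generate_ring S (B \<union> C) \<in> intermediate_rings R S"
    and "B \<subseteq> generate_ring S (B \<union> C)" and "C \<subseteq> generate_ring S (B \<union> C)"
    and "\<lbrakk>V \<in> intermediate_rings R S; B \<subseteq> V; C \<subseteq> V\<rbrakk> \<Longrightarrow> generate_ring S (B \<union> C) \<subseteq> V"
proof -
  let ?G = "generate_ring S (B \<union> C)"
  have Upper: "V \<in> Upper (extension_order R S) {B, C} \<longleftrightarrow>
      V \<in> intermediate_rings R S \<and> B \<subseteq> V \<and> C \<subseteq> V" for V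
    using assms(2,3) by (auto simp: Upper_def)
  have lub: "?G \<in> Upper (extension_order R S) {B, C}"
    "\<forall>V\<in>Upper (extension_order R S) {B, C}. ?G \<subseteq> V"
    using lub_extension_order[OF assms] by (simp_all add: least_def)
  show "?G \<in> intermediate_rings R S" "B \<subseteq> ?G" "C \<subseteq> ?G"
    using lub(1) unfolding Upper by blast+
  show "?G \<subseteq> V" if "V \<in> intermediate_rings R S" "B \<subseteq> V" "C \<subseteq> V"
    using lub(2) Upper that by blast
qed

lemma inter_intermediate:
  assumes "cring S" "A \<in> intermediate_rings R S" "B \<in> intermediate_rings R S"
  shows "A \<inter> B \<in> intermediate_rings R S"
  using glb_extension_order[OF assms] by (simp add: greatest_def Lower_def)

text \<open>
  In any lattice \<open>(x \<sqinter> y) \<squnion> (x \<sqinter> z) \<sqsubseteq> x \<sqinter> (y \<squnion> z)\<close>, so distributivity is the other inequality.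
\<close>

lemma distributive_extension_iff:
  assumes "cring S"
  shows "distributive_extension R S \<longleftrightarrow>
    (\<forall>A\<in>intermediate_rings R S. \<forall>B\<in>intermediate_rings R S. \<forall>C\<in>intermediate_rings R S.
      A \<inter> generate_ring S (B \<union> C) \<subseteq> generate_ring S ((A \<inter> B) \<union> (A \<inter> C)))"
    (is "_ \<longleftrightarrow> ?incl")
proof -
  have le: "generate_ring S ((A \<inter> B) \<union> (A \<inter> C)) \<subseteq> A \<inter> generate_ring S (B \<union> C)"
    if "A \<in> intermediate_rings R S" "B \<in> intermediate_rings R S" "C \<in> intermediate_rings R S"
    for A B C
    using that assms generate_ring_intermediate[of S B R C]
    by (intro generate_ring_intermediate(4)[where R = R] inter_intermediate) auto
  have "distributive_extension R S \<longleftrightarrow>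
    (\<forall>A\<in>intermediate_rings R S. \<forall>B\<in>intermediate_rings R S. \<forall>C\<in>intermediate_rings R S.
      A \<inter> generate_ring S (B \<union> C) = generate_ring S ((A \<inter> B) \<union> (A \<inter> C)))"
    using assms lattice_extension_order[of S R]
    by (simp add: distributive_extension_def distributive_lattice_def
        distributive_lattice_axioms_def meet_extension_order join_extension_order
        generate_ring_intermediate(1) inter_intermediate Ball_def)
  also have "\<dots> \<longleftrightarrow> ?incl"
    by (intro ball_cong refl) (simp add: set_eq_subset le[simplified])
  finally show ?thesis .
qed

text \<open>
  Distributivity of \<open>T \<subseteq> U\<close> expressed in the ambient ring \<open>S\<close>, so that all intervals can be
  compared with each other and with the whole extension.
\<close>

lemma distributive_extension_carrier_update_iff:
  assumes "cring S" "subcring U S"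
  shows "distributive_extension T (S\<lparr>carrier := U\<rparr>) \<longleftrightarrow>
    (\<forall>A\<in>intermediate_rings T (S\<lparr>carrier := U\<rparr>). \<forall>B\<in>intermediate_rings T (S\<lparr>carrier := U\<rparr>).
     \<forall>C\<in>intermediate_rings T (S\<lparr>carrier := U\<rparr>).
      A \<inter> generate_ring S (B \<union> C) \<subseteq> generate_ring S ((A \<inter> B) \<union> (A \<inter> C)))"
proof -
  interpret cring S by fact
  have U: "subring U S"
    by (rule subcring.axioms(1)[OF assms(2)])
  have cring_U: "cring (S\<lparr>carrier := U\<rparr>)"
    by (rule iffD1[OF subcring_iff[OF subcringE(1)[OF assms(2)]] assms(2)])
  have gen: "generate_ring (S\<lparr>carrier := U\<rparr>) K = generate_ring S K" if "K \<subseteq> U" for K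
    using subring_gen_equality[OF U that] by simp
  have sub: "V \<subseteq> U" if "V \<in> intermediate_rings T (S\<lparr>carrier := U\<rparr>)" for V
    using that assms by (simp add: intermediate_rings_carrier_update)
  have "generate_ring (S\<lparr>carrier := U\<rparr>) (B \<union> C) = generate_ring S (B \<union> C)"
    "generate_ring (S\<lparr>carrier := U\<rparr>) ((A \<inter> B) \<union> (A \<inter> C)) = generate_ring S ((A \<inter> B) \<union> (A \<inter> C))"
    if "B \<in> intermediate_rings T (S\<lparr>carrier := U\<rparr>)" "C \<in> intermediate_rings T (S\<lparr>carrier := U\<rparr>)"
    for A B C
    using sub[OF that(1)] sub[OF that(2)] by (auto intro!: gen)
  then show ?thesis
    by (simp add: distributive_extension_iff[OF cring_U])
qed

text \<open>
  The inequality holds in every lattice for these triples. In an ordinal sum every triple that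
  does not lie in a single summand is of this kind.
\<close>

lemma generate_ring_distrib_trivial:
  assumes "cring S"
    and A: "A \<in> intermediate_rings R S"
    and B: "B \<in> intermediate_rings R S" and C: "C \<in> intermediate_rings R S"
    and "B \<subseteq> C \<or> C \<subseteq> B \<or> A \<subseteq> B \<or> B \<union> C \<subseteq> A"
  shows "A \<inter> generate_ring S (B \<union> C) \<subseteq> generate_ring S ((A \<inter> B) \<union> (A \<inter> C))"
proof -
  have incl: "(A \<inter> B) \<union> (A \<inter> C) \<subseteq> generate_ring S ((A \<inter> B) \<union> (A \<inter> C))"
    by (auto intro: generate_ring.incl)
  note gen_le = generate_ring_intermediate(4)[OF \<open>cring S\<close> B C]
  consider "B \<subseteq> C" | "C \<subseteq> B" | "A \<subseteq> B" | "B \<union> C \<subseteq> A"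
    using assms(5) by blast
  then show ?thesis
  proof cases
    case 1
    then show ?thesis using gen_le[OF C] incl by blast
  next
    case 2
    then show ?thesis using gen_le[OF B] incl by blast
  next
    case 3
    then show ?thesis using incl by blast
  next
    case 4
    then have "(A \<inter> B) \<union> (A \<inter> C) = B \<union> C" by blast
    then show ?thesis by simp
  qed
qed

theorem corollary3p2:
  fixes R :: "'a set" and S :: "('a, 'b) ring_scheme" and n :: nat and T :: "nat \<Rightarrow> 'a set"
  assumes "cring S" and "subcring R S" and "R \<subset> carrier S"
    and "FCP_extension R S"
    and "n \<ge> 1"
    and "\<forall>i\<in>{1..n}. T i \<in> intermediate_rings R S - {R, carrier S}"
    and "\<forall>i\<in>{1..<n}. T i \<subset> T (Suc i)"
    and "T 0 = R" and "T (Suc n) = carrier S"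
    and "pinched_at R S n T"
  shows "distributive_extension R S \<longleftrightarrow>
    (\<forall>i\<in>{0..n}. distributive_extension (T i) (S\<lparr>carrier := T (Suc i)\<rparr>))"
proof -
  interpret cring S by (rule assms(1))
  let ?I = "intermediate_rings R S"
  let ?J = "\<lambda>i. intermediate_rings (T i) (S\<lparr>carrier := T (Suc i)\<rparr>)"
  let ?P = "\<lambda>A B C. A \<inter> generate_ring S (B \<union> C) \<subseteq> generate_ring S ((A \<inter> B) \<union> (A \<inter> C))"
  have T_mem: "T i \<in> ?I" if i: "i \<le> Suc n" for i
  proof -
    consider "i = 0" | "i \<in> {1..n}" | "i = Suc n"
      using i by fastforce
    then show ?thesis
    proof cases
      case 1
      then show ?thesis using assms(2,8) by (simp add: intermediate_rings_def)
    next
      case 2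
      then show ?thesis using assms(6) by blast
    next
      case 3
      then show ?thesis using assms(3,9) carrier_is_subcring by (auto simp: intermediate_rings_def)
    qed
  qed
  then have T_sub: "subcring (T (Suc i)) S" if "i \<in> {0..n}" for i
    using that by (simp add: intermediate_rings_def)
  have T_step: "T i \<subseteq> T (Suc i)" if i: "i \<le> n" for i
  proof -
    consider "i = 0" | "i \<in> {1..<n}" | "i = n"
      using i by fastforce
    then show ?thesis
    proof cases
      case 1
      then show ?thesis using T_mem[of 1] assms(5,8) by (auto simp: intermediate_rings_def)
    next
      case 2
      then show ?thesis using assms(7) by blast
    next
      case 3
      then show ?thesis using T_mem[of n] assms(9) subcringE(1)[of "T n" S] by (auto simp: intermediate_rings_def)
    qed
  qed
  have T_mono: "T i \<subseteq> T j" if "i \<le> j" "j \<le> Suc n" for i j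
    using that
  proof (induction rule: dec_induct)
    case (step k)
    then show ?case using T_step[of k] by auto
  qed simp
  have bounds: "T i \<subseteq> V" "V \<subseteq> T (Suc i)" if "i \<in> {0..n}" "V \<in> ?J i" for i V
    using that subcringE(1)[of V "S\<lparr>carrier := T (Suc i)\<rparr>"] by (simp_all add: intermediate_rings_def)
  have ordered: "V \<subseteq> W" if "i \<in> {0..n}" "V \<in> ?J i" "j \<in> {0..n}" "W \<in> ?J j" "i < j" for i j V W
    using bounds[of i V] bounds[of j W] T_mono[of "Suc i" j] that by auto
  have I_eq: "?I = (\<Union>i\<in>{0..n}. ?J i)"
    using assms(10) by (simp add: pinched_at_def)
  have pieces: "distributive_extension (T i) (S\<lparr>carrier := T (Suc i)\<rparr>) \<longleftrightarrow>
      (\<forall>A\<in>?J i. \<forall>B\<in>?J i. \<forall>C\<in>?J i. ?P A B C)" if "i \<in> {0..n}" for i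
    using distributive_extension_carrier_update_iff[OF assms(1) T_sub[OF that]] .
  have "(\<forall>A\<in>?I. \<forall>B\<in>?I. \<forall>C\<in>?I. ?P A B C) \<longleftrightarrow>
      (\<forall>i\<in>{0..n}. \<forall>A\<in>?J i. \<forall>B\<in>?J i. \<forall>C\<in>?J i. ?P A B C)"
  proof
    assume "\<forall>A\<in>?I. \<forall>B\<in>?I. \<forall>C\<in>?I. ?P A B C"
    then show "\<forall>i\<in>{0..n}. \<forall>A\<in>?J i. \<forall>B\<in>?J i. \<forall>C\<in>?J i. ?P A B C"
      unfolding I_eq by blast
  next
    assume local: "\<forall>i\<in>{0..n}. \<forall>A\<in>?J i. \<forall>B\<in>?J i. \<forall>C\<in>?J i. ?P A B C"
    show "\<forall>A\<in>?I. \<forall>B\<in>?I. \<forall>C\<in>?I. ?P A B C"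
    proof (intro ballI)
      fix A B C
      assume ABC: "A \<in> ?I" "B \<in> ?I" "C \<in> ?I"
      obtain i j k where ijk: "i \<in> {0..n}" "A \<in> ?J i" "j \<in> {0..n}" "B \<in> ?J j" "k \<in> {0..n}" "C \<in> ?J k"
        using ABC I_eq by blast
      show "?P A B C"
      proof (cases "i = j \<and> j = k")
        case True
        then show ?thesis using local ijk by blast
      next
        case False
        then consider "j < k" | "k < j" | "j = k" "i < j" | "j = k" "j < i"
          by linarith
        then have "B \<subseteq> C \<or> C \<subseteq> B \<or> A \<subseteq> B \<or> B \<union> C \<subseteq> A"
          using ordered ijk by cases (blast+)
        then show ?thesis
          using generate_ring_distrib_trivial[OF assms(1) ABC] by blast
      qed
    qed
  qed
  then show ?thesis
    using pieces by (simp add: distributive_extension_iff[OF assms(1)])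
qed

end
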